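(* Let $(X,\|\cdot\|)$ be a real normed space, let $n\ge2$, and let $v_1,\ldots,v_n\in X$ be distinct vectors. Let $\mathrm{Sol}$ be the set of all global minimizers over $u\in X$ of $f(u):=\max_{1\le i\le n}\|u-v_i\|$. Then a vector $\bar u\in X$ belongs to $\mathrm{Sol}$ if and only if there exist $x_1^*,\ldots,x_n^*\in X^*$ such that $$\sum_{i=1}^n x_i^*=0,\qquad \sum_{i=1}^n\|x_i^*\|^*=1,$$ $$\langle x_i^*,\bar u-v_i\rangle=\|x_i^*\|^*\cdot\|\bar u-v_i\|,\qquad \Big(\|\bar u-v_i\|-\max_{1\le j\le n}\|\bar u-v_j\|\Big)\cdot\|x_i^*\|^*=0\qquad(i=1,\ldots,n).$$ Moreover, if $\bar u\in\mathrm{Sol}$ and $x_1^*,\ldots,x_n^*$ satisfy these conditions, then $$\mathrm{Sol}=\bigcap_{i:\;x_i^*\ne0}\Big\{u\in X\;\Big|\;\langle x_i^*,u-v_i\rangle=\|x_i^*\|^*\cdot\max_{1\le j\le n}\|u-v_j\|\Big\}.$$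
   Context: $X^*$ is the topological dual of $X$, $\|\cdot\|^*$ the dual norm on $X^*$, and $\langle\cdot,\cdot\rangle$ the duality pairing. *)

theory Defs
  imports "HOL-Analysis.Analysis"
begin

text \<open>
  The topological dual of a real normed space is the type of bounded linear maps
  into the reals, whose norm is the operator norm. Families indexed by
  \<open>1, \<dots>, n\<close> are functions on \<open>nat\<close>; values outside \<open>{1..n}\<close> are ignored.
\<close>

type_synonym 'a dual = "'a \<Rightarrow>\<^sub>L real"

definition max_dist :: "nat \<Rightarrow> (nat \<Rightarrow> 'a::real_normed_vector) \<Rightarrow> 'a \<Rightarrow> real" where
  "max_dist n v u = (MAX i\<in>{1..n}. norm (u - v i))"

definition Sol :: "nat \<Rightarrow> (nat \<Rightarrow> 'a::real_normed_vector) \<Rightarrow> 'a set" where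
  "Sol n v = {u. \<forall>w. max_dist n v u \<le> max_dist n v w}"

definition optimality_system ::
  "nat \<Rightarrow> (nat \<Rightarrow> 'a::real_normed_vector) \<Rightarrow> 'a \<Rightarrow> (nat \<Rightarrow> 'a dual) \<Rightarrow> bool" where
  "optimality_system n v u x \<longleftrightarrow>
     (\<Sum>i=1..n. x i) = 0 \<and>
     (\<Sum>i=1..n. norm (x i)) = 1 \<and>
     (\<forall>i\<in>{1..n}.
        blinfun_apply (x i) (u - v i) = norm (x i) * norm (u - v i) \<and>
        (norm (u - v i) - max_dist n v u) * norm (x i) = 0)"

end

theory Submission
  imports Defs "HOL-Analysis.Finite_Function_Topology"
begin

text \<open>
  On the space of configurations \<open>z = (z\<^sub>1, \<dots>, z\<^sub>n)\<close>, the Chebyshev radius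
  \<open>\<rho>(z) = inf\<^sub>w max\<^sub>i \<parallel>w - z\<^sub>i\<parallel>\<close> is sublinear. Hahn--Banach yields a linear \<open>\<phi> \<le> \<rho>\<close> with
  \<open>\<phi>(v) = \<rho>(v)\<close>. Since \<open>\<rho>\<close> vanishes on constant configurations and is bounded by the maximum
  norm, the negated components of \<open>\<phi>\<close> are functionals with sum \<open>0\<close> whose norms add up to at
  most \<open>1\<close>. Conversely, if \<open>\<Sum> x\<^sub>i = 0\<close> then \<open>\<Sum> \<langle>x\<^sub>i, w - v\<^sub>i\<rangle>\<close> does not depend on \<open>w\<close>, and
  at a solution of the system it equals the value of the objective; comparing it termwise
  with \<open>\<Sum> \<parallel>x\<^sub>i\<parallel> max\<^sub>j \<parallel>w - v\<^sub>j\<parallel>\<close> gives all remaining claims.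
\<close>

section \<open>Sublinear functionals and the Hahn--Banach theorem\<close>

definition sublinear :: "('a::real_vector \<Rightarrow> real) \<Rightarrow> bool" where
  "sublinear p \<longleftrightarrow>
     (\<forall>x y. p (x + y) \<le> p x + p y) \<and> (\<forall>c x. 0 \<le> c \<longrightarrow> p (c *\<^sub>R x) = c * p x)"

lemma sublinear_add: "sublinear p \<Longrightarrow> p (x + y) \<le> p x + p y"
  by (simp add: sublinear_def)

lemma sublinear_scaleR: "sublinear p \<Longrightarrow> 0 \<le> c \<Longrightarrow> p (c *\<^sub>R x) = c * p x"
  by (simp add: sublinear_def)

lemma sublinear_zero: "sublinear p \<Longrightarrow> p 0 = 0"
  using sublinear_scaleR[of p 0 0] by simp

lemma sublinear_minus: "sublinear p \<Longrightarrow> - p (- x) \<le> p x"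
  using sublinear_add[of p x "- x"] by (simp add: sublinear_zero)

text \<open>An infimum directly yields only one inequality for positive factors; applying it to the
  factor \<open>inverse c\<close> and the vector \<open>c *\<^sub>R x\<close> reverses it.\<close>

lemma sublinearI:
  assumes add: "\<And>x y. p (x + y) \<le> p x + p y"
    and scale: "\<And>c x. 0 < c \<Longrightarrow> p (c *\<^sub>R x) \<le> c * p x"
    and zero: "p 0 = 0"
  shows "sublinear p"
proof -
  have "p (c *\<^sub>R x) = c * p x" if "0 \<le> c" for c x
  proof (cases "c = 0")
    case False
    with that have c: "0 < c" by simp
    have "p x \<le> inverse c * p (c *\<^sub>R x)"
      using scale[of "inverse c" "c *\<^sub>R x"] c by simp
    then have "c * p x \<le> p (c *\<^sub>R x)"
      using c by (simp add: field_simps)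
    with scale[OF c, of x] show ?thesis by simp
  qed (simp add: zero)
  with add show ?thesis by (simp add: sublinear_def)
qed

text \<open>The index \<open>k\<close> may depend on both indices and both points. This covers
  chains (\<open>k\<close> is the smaller member) as well as shifts along a ray and centres of
  configurations (\<open>k\<close> is the sum).\<close>

context
  fixes F :: "'i \<Rightarrow> 'a::real_vector \<Rightarrow> real" and J :: "'i set"
  assumes ne: "J \<noteq> {}"
    and add: "\<And>i j x y. i \<in> J \<Longrightarrow> j \<in> J \<Longrightarrow> \<exists>k\<in>J. F k (x + y) \<le> F i x + F j y"
    and nonneg: "\<And>i. i \<in> J \<Longrightarrow> 0 \<le> F i 0"
begin

text \<open>A fixed index \<open>j\<close> gives the lower bound \<open>- F j (- x)\<close>, since
  \<open>0 \<le> F k 0 \<le> F i x + F j (- x)\<close> for a suitable \<open>k\<close>.\<close>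

lemma bdd_below_pointwise: "bdd_below ((\<lambda>i. F i x) ` J)"
proof -
  obtain j where j: "j \<in> J" using ne by blast
  have "- F j (- x) \<le> F i x" if i: "i \<in> J" for i
  proof -
    obtain k where "k \<in> J" "F k (x + - x) \<le> F i x + F j (- x)"
      using add[OF i j] by blast
    with nonneg[of k] show ?thesis by simp
  qed
  then show ?thesis by (auto intro!: bdd_belowI)
qed

lemma pointwise_INF_lower: "i \<in> J \<Longrightarrow> (INF i\<in>J. F i x) \<le> F i x"
  by (rule cINF_lower[OF bdd_below_pointwise])

lemma sublinear_INF:
  assumes scale: "\<And>c i x. 0 < c \<Longrightarrow> i \<in> J \<Longrightarrow> \<exists>k\<in>J. F k (c *\<^sub>R x) \<le> c * F i x"
    and zero: "\<exists>i\<in>J. F i 0 \<le> 0"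
  shows "sublinear (\<lambda>x. INF i\<in>J. F i x)"
proof (rule sublinearI)
  fix x y
  have *: "(INF k\<in>J. F k (x + y)) \<le> F i x + F j y" if "i \<in> J" "j \<in> J" for i j
    using add[OF that, of x y] pointwise_INF_lower[of _ "x + y"] by force
  have "(INF k\<in>J. F k (x + y)) - F i x \<le> (INF j\<in>J. F j y)" if "i \<in> J" for i
    using *[OF that] by (intro cINF_greatest ne) (simp add: algebra_simps)
  then have "(INF k\<in>J. F k (x + y)) - (INF j\<in>J. F j y) \<le> (INF i\<in>J. F i x)"
    by (intro cINF_greatest ne) (simp add: algebra_simps)
  then show "(INF k\<in>J. F k (x + y)) \<le> (INF i\<in>J. F i x) + (INF j\<in>J. F j y)"
    by simp
next
  fix c :: real and x
  assume c: "0 < c"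
  have "(INF k\<in>J. F k (c *\<^sub>R x)) / c \<le> F i x" if "i \<in> J" for i
  proof -
    obtain k where "k \<in> J" "F k (c *\<^sub>R x) \<le> c * F i x"
      using scale[OF c \<open>i \<in> J\<close>] by blast
    then have "(INF k\<in>J. F k (c *\<^sub>R x)) \<le> c * F i x"
      using pointwise_INF_lower[of k "c *\<^sub>R x"] by simp
    then show ?thesis using c by (simp add: field_simps)
  qed
  then have "(INF k\<in>J. F k (c *\<^sub>R x)) / c \<le> (INF i\<in>J. F i x)"
    by (intro cINF_greatest ne)
  then show "(INF k\<in>J. F k (c *\<^sub>R x)) \<le> c * (INF i\<in>J. F i x)"
    using c by (simp add: field_simps)
next
  obtain i where i: "i \<in> J" "F i 0 \<le> 0" using zero by blast
  show "(INF i\<in>J. F i 0) = 0"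
  proof (rule antisym)
    show "(INF i\<in>J. F i 0) \<le> 0"
      using pointwise_INF_lower[OF i(1), of 0] i(2) by simp
    show "0 \<le> (INF i\<in>J. F i 0)"
      using nonneg by (intro cINF_greatest ne)
  qed
qed

end

text \<open>The pointwise infimum of the chain works, because the smaller of two members satisfies
  the mixed subadditivity estimate. This supplies the bounds for Zorn's lemma.\<close>

lemma sublinear_chain_lower_bound:
  assumes ne: "C \<noteq> {}" and sub: "\<And>q. q \<in> C \<Longrightarrow> sublinear q"
    and chain: "\<And>q r. q \<in> C \<Longrightarrow> r \<in> C \<Longrightarrow> q \<le> r \<or> r \<le> q"
  obtains m where "sublinear m" "\<And>q. q \<in> C \<Longrightarrow> m \<le> q"
proof
  have add: "\<exists>k\<in>C. k (x + y) \<le> q x + r y" if "q \<in> C" "r \<in> C" for q r x y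
    using chain[OF that]
  proof
    assume "q \<le> r"
    then have "q (x + y) \<le> q x + r y"
      using sublinear_add[OF sub[OF \<open>q \<in> C\<close>], of x y] le_funD[of q r y] by linarith
    with that show ?thesis by blast
  next
    assume "r \<le> q"
    then have "r (x + y) \<le> q x + r y"
      using sublinear_add[OF sub[OF \<open>r \<in> C\<close>], of x y] le_funD[of r q x] by linarith
    with that show ?thesis by blast
  qed
  have zero: "q 0 = 0" if "q \<in> C" for q
    using sublinear_zero sub that by blast
  show "sublinear (\<lambda>x. INF q\<in>C. q x)"
  proof (rule sublinear_INF[OF ne])
    show "\<exists>k\<in>C. k (c *\<^sub>R x) \<le> c * q x" if "0 < c" "q \<in> C" for c q x
      using sublinear_scaleR[OF sub[OF that(2)], of c x] that by (intro bexI[of _ q]) auto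
    show "\<exists>q\<in>C. q 0 \<le> 0" using ne zero by force
  qed (use add zero in fastforce)+
  show "(\<lambda>x. INF q\<in>C. q x) \<le> q" if "q \<in> C" for q
    by (rule le_funI, rule pointwise_INF_lower[OF ne _ _ that]) (use add zero in fastforce)+
qed

text \<open>Take the infimum over \<open>t \<ge> 0\<close> of
  \<open>m (x + t *\<^sub>R y) - t * m y\<close>: the choice \<open>t = 0\<close> gives
  \<open>q \<le> m\<close>, and \<open>t = 1\<close> at \<open>- y\<close> gives
  \<open>m 0 - m y = - m y\<close>.\<close>

lemma sublinear_improve:
  assumes m: "sublinear m"
  obtains q where "sublinear q" "q \<le> m" "q (- y) \<le> - m y"
proof
  define F where "F t x = m (x + t *\<^sub>R y) - t * m y" for t x
  let ?J = "{0::real..}"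
  let ?q = "\<lambda>x. INF t\<in>?J. F t x"
  have ne: "?J \<noteq> {}" by auto
  have add: "\<exists>k\<in>?J. F k (x + z) \<le> F s x + F t z" if "s \<in> ?J" "t \<in> ?J" for s t x z
  proof
    show "F (s + t) (x + z) \<le> F s x + F t z"
      using sublinear_add[OF m, of "x + s *\<^sub>R y" "z + t *\<^sub>R y"]
      by (simp add: F_def algebra_simps)
    show "s + t \<in> ?J" using that by simp
  qed
  have zero: "F t 0 = 0" if "t \<in> ?J" for t
    using that sublinear_scaleR[OF m] by (simp add: F_def)
  have nonneg: "0 \<le> F t 0" if "t \<in> ?J" for t
    using zero[OF that] by simp
  note lower = pointwise_INF_lower[of ?J F, OF ne add nonneg]
  show "sublinear ?q"
  proof (rule sublinear_INF[OF ne add nonneg])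
    show "\<exists>k\<in>?J. F k (c *\<^sub>R x) \<le> c * F t x" if "0 < c" "t \<in> ?J" for c t x
    proof
      show "F (c * t) (c *\<^sub>R x) \<le> c * F t x"
        using sublinear_scaleR[OF m, of c "x + t *\<^sub>R y"] that
        by (simp add: F_def algebra_simps)
      show "c * t \<in> ?J" using that by simp
    qed
    show "\<exists>t\<in>?J. F t 0 \<le> 0" using zero by force
  qed
  show "?q \<le> m"
  proof (rule le_funI)
    show "?q x \<le> m x" for x
      using lower[of 0 x] by (simp add: F_def)
  qed
  show "?q (- y) \<le> - m y"
    using lower[of 1 "- y"] by (simp add: F_def sublinear_zero[OF m])
qed

text \<open>Minimal sublinear functionals are linear, since they cannot be improved in any direction.\<close>

lemma Hahn_Banach_sublinear:
  assumes p: "sublinear (p :: 'a::real_vector \<Rightarrow> real)"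
  obtains f where "linear f" "\<And>x. f x \<le> p x" "f x\<^sub>0 = p x\<^sub>0"
proof -
  \<comment> \<open>Improving \<open>p\<close> in the direction \<open>x\<^sub>0\<close> first
    forces every odd \<open>m \<le> p'\<close> to satisfy
    \<open>- m x\<^sub>0 \<le> - p x\<^sub>0\<close>, so that a linear minorant touches
    \<open>p\<close> at \<open>x\<^sub>0\<close>.\<close>
  obtain p' where p': "sublinear p'" "p' \<le> p" "p' (- x\<^sub>0) \<le> - p x\<^sub>0"
    using sublinear_improve[OF p] by blast
  define A where "A = {q. sublinear q \<and> q \<le> p'}"
  \<comment> \<open>Zorn's lemma is used for the reversed order, so a chain needs a pointwise lower
    bound in \<open>A\<close>; \<open>p'\<close> serves for the empty chain.\<close>
  have "\<exists>m\<in>A. \<forall>q\<in>A. m \<ge> q \<longrightarrow> q = m"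
  proof (rule predicate_Zorn)
    show "partial_order_on A (relation_of (\<ge>) A)"
      by (rule partial_order_on_relation_ofI) auto
    fix C assume "C \<in> Chains (relation_of (\<ge>) A)"
    then have C: "C \<subseteq> A" "\<And>q r. q \<in> C \<Longrightarrow> r \<in> C \<Longrightarrow> q \<le> r \<or> r \<le> q"
      by (auto simp: Chains_def relation_of_def)
    show "\<exists>u\<in>A. \<forall>a\<in>C. a \<ge> u"
    proof (cases "C = {}")
      case True
      with p' show ?thesis by (auto simp: A_def)
    next
      case False
      obtain m where m: "sublinear m" "\<And>q. q \<in> C \<Longrightarrow> m \<le> q"
        using sublinear_chain_lower_bound[OF False, of thesis] C by (auto simp: A_def)
      from False C m have "m \<in> A" by (force simp: A_def intro: order_trans)
      with m show ?thesis by blast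
    qed
  qed
  then obtain m where m: "sublinear m" "m \<le> p'"
    and minimal: "\<And>q. sublinear q \<Longrightarrow> q \<le> m \<Longrightarrow> q = m"
    by (force simp: A_def intro: order_trans)
  have neg: "m (- x) = - m x" for x
  proof (rule antisym)
    obtain q where "sublinear q" "q \<le> m" "q (- x) \<le> - m x"
      using sublinear_improve[OF m(1)] by blast
    then show "m (- x) \<le> - m x" using minimal by blast
    show "- m x \<le> m (- x)" using sublinear_minus[OF m(1), of x] by linarith
  qed
  have "linear m"
  proof (rule linearI)
    fix x y
    \<comment> \<open>Oddness turns subadditivity at \<open>- x\<close>, \<open>- y\<close> into
      superadditivity at \<open>x\<close>, \<open>y\<close>.\<close>
    show "m (x + y) = m x + m y"
      using sublinear_add[OF m(1), of x y] sublinear_add[OF m(1), of "- x" "- y"]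
        neg[of x] neg[of y] neg[of "x + y"] by simp
  next
    fix c x
    show "m (c *\<^sub>R x) = c *\<^sub>R m x"
    proof (cases "0 \<le> c")
      case False
      then have "m ((- c) *\<^sub>R x) = - c * m x"
        by (intro sublinear_scaleR m) simp
      then show ?thesis using neg[of "c *\<^sub>R x"] by simp
    qed (simp add: sublinear_scaleR[OF m(1)])
  qed
  moreover have le: "m x \<le> p x" for x
    using m(2) p'(2) by (metis le_funD order_trans)
  moreover have "m x\<^sub>0 = p x\<^sub>0"
    using neg[of x\<^sub>0] le_funD[OF m(2), of "- x\<^sub>0"] p'(3) le[of x\<^sub>0] by simp
  ultimately show thesis by (rule that)
qed

text \<open>Otherwise \<open>norm f - e\<close> would bound \<open>f\<close> on the unit ball and
  hence its operator norm. The slack \<open>e\<close> is there because the norm need not be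
  attained.\<close>

lemma blinfun_nearly_norming:
  fixes f :: "'a::real_normed_vector \<Rightarrow>\<^sub>L real"
  assumes "0 < e"
  shows "\<exists>a. norm a \<le> 1 \<and> norm f - e < f a"
proof (rule ccontr)
  assume "\<not> ?thesis"
  then have le: "f a \<le> norm f - e" if "norm a \<le> 1" for a
    using that by force
  have "norm f \<le> norm f - e"
  proof (rule norm_blinfun_bound)
    show "0 \<le> norm f - e" using le[of 0] by simp
    show "norm (f x) \<le> (norm f - e) * norm x" for x
    proof (cases "x = 0")
      case False
      have "f ((1 / norm x) *\<^sub>R x) \<le> norm f - e" "f (- (1 / norm x) *\<^sub>R x) \<le> norm f - e"
        by (rule le, simp)+
      then show ?thesis
        using False by (simp add: blinfun.bilinear_simps field_simps)
    qed simp
  qed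
  with assms show False by simp
qed

section \<open>The Chebyshev radius of a configuration\<close>

lemma max_dist_le_iff:
  "1 \<le> n \<Longrightarrow> max_dist n v u \<le> c \<longleftrightarrow> (\<forall>i\<in>{1..n}. norm (u - v i) \<le> c)"
  by (simp add: max_dist_def)

lemma norm_le_max_dist: "i \<in> {1..n} \<Longrightarrow> norm (u - v i) \<le> max_dist n v u"
  by (simp add: max_dist_def)

lemma max_dist_nonneg: "1 \<le> n \<Longrightarrow> 0 \<le> max_dist n v u"
  using norm_le_max_dist[of 1 n u v] norm_ge_zero[of "u - v 1"]
  by (simp del: norm_ge_zero)

text \<open>No \<open>u\<close> is at distance zero from both \<open>v 1\<close> and
  \<open>v 2\<close>. Positivity later permits cancelling the optimal value.\<close>

lemma max_dist_pos:
  assumes "n \<ge> 2" and "inj_on v {1..n}"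
  shows "0 < max_dist n v u"
proof -
  have "v 1 \<noteq> v 2" using inj_onD[OF assms(2), of 1 2] assms(1) by auto
  then have "0 < norm (u - v 1) \<or> 0 < norm (u - v 2)" by auto
  then show ?thesis
    using norm_le_max_dist[of 1 n u v] norm_le_max_dist[of 2 n u v] assms(1)
    by (auto simp del: zero_less_norm_iff)
qed

section \<open>Configurations as finitely supported maps and their radius\<close>

lemma lookup_scaleR: "Poly_Mapping.lookup (c *\<^sub>R z) i = c *\<^sub>R Poly_Mapping.lookup z i"
  unfolding scaleR_poly_mapping_def
  by (subst Abs_poly_mapping_inverse)
    (auto intro: finite_subset[OF _ finite_lookup[of z]])

text \<open>
  Configurations are finitely supported maps, because these form a vector space for every
  \<open>n\<close>; components outside \<open>{1..n}\<close> are irrelevant.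
\<close>

definition chebyshev_radius :: "nat \<Rightarrow> (nat \<Rightarrow>\<^sub>0 'a::real_normed_vector) \<Rightarrow> real" where
  "chebyshev_radius n z = (INF w. max_dist n (Poly_Mapping.lookup z) w)"

text \<open>The maximal distance is sublinear in centre and configuration jointly, and this passes
  to the infimum over centres.\<close>

lemma chebyshev_radius:
  fixes z :: "nat \<Rightarrow>\<^sub>0 'a::real_normed_vector"
  assumes n: "1 \<le> n"
  shows sublinear_chebyshev_radius:
      "sublinear (chebyshev_radius n :: (nat \<Rightarrow>\<^sub>0 'a) \<Rightarrow> real)"
    and chebyshev_radius_le: "chebyshev_radius n z \<le> max_dist n (Poly_Mapping.lookup z) w"
proof -
  define F where "F w z = max_dist n (Poly_Mapping.lookup z) w" for w :: 'a and z
  have eq: "chebyshev_radius n = (\<lambda>z. INF w\<in>UNIV. F w z)"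
    by (auto simp: chebyshev_radius_def F_def)
  have add: "\<exists>k\<in>UNIV. F k (y + z) \<le> F w y + F w' z" for w w' y z
  proof -
    have "F (w + w') (y + z) \<le> F w y + F w' z"
      unfolding F_def max_dist_le_iff[OF n]
    proof
      fix i assume i: "i \<in> {1..n}"
      have "norm (w + w' - Poly_Mapping.lookup (y + z) i)
          \<le> norm (w - Poly_Mapping.lookup y i) + norm (w' - Poly_Mapping.lookup z i)"
        using norm_triangle_ineq[of "w - Poly_Mapping.lookup y i" "w' - Poly_Mapping.lookup z i"]
        by (simp add: lookup_add algebra_simps)
      also have "\<dots> \<le> max_dist n (Poly_Mapping.lookup y) w + max_dist n (Poly_Mapping.lookup z) w'"
        by (intro add_mono norm_le_max_dist i)
      finally show "norm (w + w' - Poly_Mapping.lookup (y + z) i) \<le> \<dots>" .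
    qed
    then show ?thesis by blast
  qed
  have nonneg: "0 \<le> F w 0" for w
    by (simp add: F_def max_dist_nonneg[OF n])
  show "sublinear (chebyshev_radius n :: (nat \<Rightarrow>\<^sub>0 'a) \<Rightarrow> real)"
    unfolding eq
  proof (rule sublinear_INF)
    show "\<exists>k\<in>UNIV. F k (c *\<^sub>R z) \<le> c * F w z" if "0 < c" for c w z
    proof -
      have "F (c *\<^sub>R w) (c *\<^sub>R z) \<le> c * F w z"
        unfolding F_def max_dist_le_iff[OF n]
      proof
        fix i assume i: "i \<in> {1..n}"
        have "norm (c *\<^sub>R w - Poly_Mapping.lookup (c *\<^sub>R z) i)
            = c * norm (w - Poly_Mapping.lookup z i)"
          using that by (simp add: lookup_scaleR flip: scaleR_diff_right)
        with that norm_le_max_dist[OF i, of w "Poly_Mapping.lookup z"]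
        show "norm (c *\<^sub>R w - Poly_Mapping.lookup (c *\<^sub>R z) i)
            \<le> c * max_dist n (Poly_Mapping.lookup z) w"
          by simp
      qed
      then show ?thesis by blast
    qed
    have "F 0 0 \<le> 0" by (simp add: F_def max_dist_le_iff[OF n])
    then show "\<exists>w\<in>UNIV. F w 0 \<le> 0" by blast
  qed (use add nonneg in auto)
  have "(INF w\<in>UNIV. F w z) \<le> F w z"
    by (rule pointwise_INF_lower) (use add nonneg in auto)
  then show "chebyshev_radius n z \<le> max_dist n (Poly_Mapping.lookup z) w"
    by (simp add: eq F_def)
qed

lemma chebyshev_radius_eq:
  assumes "u \<in> Sol n v" and "1 \<le> n" and "\<And>i. i \<in> {1..n} \<Longrightarrow> Poly_Mapping.lookup z i = v i"
  shows "chebyshev_radius n z = max_dist n v u"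
proof -
  have eq: "max_dist n (Poly_Mapping.lookup z) w = max_dist n v w" for w
    using assms(3) by (simp add: max_dist_def)
  have "max_dist n v u \<le> chebyshev_radius n z"
    unfolding chebyshev_radius_def eq
    using assms(1) by (intro cINF_greatest) (auto simp: Sol_def)
  then show ?thesis
    using chebyshev_radius_le[OF assms(2), of z u] by (simp add: eq)
qed

section \<open>Optimality conditions\<close>

text \<open>Replacing \<open>u\<close> by \<open>w\<close> changes the sum by the zero functional
  evaluated at \<open>w - u\<close>.\<close>

lemma sum_blinfun_shift:
  fixes x :: "'i \<Rightarrow> 'a::real_normed_vector dual"
  assumes "(\<Sum>i\<in>I. x i) = 0"
  shows "(\<Sum>i\<in>I. x i (w - v i)) = (\<Sum>i\<in>I. x i (u - v i))"
proof -
  have "(\<Sum>i\<in>I. x i w) = 0" for w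
    using assms by (simp flip: blinfun.sum_left)
  then show ?thesis
    by (simp add: blinfun.diff_right sum_subtractf)
qed

text \<open>The minus sign in \<open>x\<close> arises because the functionals act on
  \<open>u - v i\<close>, whereas \<open>f\<close> acts on \<open>v\<close>. Here the norms are only
  bounded; equality needs a positive optimal value.\<close>

lemma dual_certificate_exists:
  fixes v :: "nat \<Rightarrow> 'a::real_normed_vector"
  assumes u: "u \<in> Sol n v" and n: "1 \<le> n"
  obtains x :: "nat \<Rightarrow> 'a dual" where
    "(\<Sum>i=1..n. x i) = 0" "(\<Sum>i=1..n. norm (x i)) \<le> 1"
    "(\<Sum>i=1..n. x i (u - v i)) = max_dist n v u"
proof -
  define config :: "(nat \<Rightarrow> 'a) \<Rightarrow> (nat \<Rightarrow>\<^sub>0 'a)" where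
    "config a = (\<Sum>i=1..n. Poly_Mapping.single i (a i))" for a
  have lookup_config: "Poly_Mapping.lookup (config a) i = a i" if "i \<in> {1..n}" for a i
    using that by (simp add: config_def lookup_sum lookup_single when_def)
  obtain f :: "(nat \<Rightarrow>\<^sub>0 'a) \<Rightarrow> real" where f: "linear f" "\<And>z. f z \<le> chebyshev_radius n z"
    "f (config v) = chebyshev_radius n (config v)"
    using Hahn_Banach_sublinear[OF sublinear_chebyshev_radius[OF n]] by blast
  \<comment> \<open>Any centre \<open>w\<close> bounds \<open>f\<close>; centre 0 will give
    continuity and the norm bound, the common value of a constant configuration will give sum
    zero.\<close>
  have f_le: "f z \<le> c" if "\<And>i. i \<in> {1..n} \<Longrightarrow> norm (w - Poly_Mapping.lookup z i) \<le> c" for z w c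
  proof -
    have "max_dist n (Poly_Mapping.lookup z) w \<le> c" using that by (simp add: max_dist_le_iff[OF n])
    with f(2)[of z] chebyshev_radius_le[OF n, of z w] show ?thesis by linarith
  qed
  define x where "x i = Blinfun (\<lambda>a. - f (Poly_Mapping.single i a))" for i
  have single_scaleR: "Poly_Mapping.single i (c *\<^sub>R a) = c *\<^sub>R Poly_Mapping.single i a"
    for i :: nat and c and a :: 'a
    by (rule poly_mapping_eqI) (simp add: lookup_single when_def lookup_scaleR)
  have "bounded_linear (\<lambda>a. - f (Poly_Mapping.single i a))" for i
  proof (rule bounded_linear_intro[where K = 1])
    fix a b :: 'a and c :: real
    show "- f (Poly_Mapping.single i (a + b))
        = - f (Poly_Mapping.single i a) + - f (Poly_Mapping.single i b)"
      by (simp add: single_add linear_add[OF f(1)])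
    show "- f (Poly_Mapping.single i (c *\<^sub>R a)) = c *\<^sub>R - f (Poly_Mapping.single i a)"
      by (simp add: single_scaleR linear_scale[OF f(1)])
    have "f (Poly_Mapping.single i a) \<le> norm a" for a
      by (rule f_le[where w = 0]) (simp add: lookup_single when_def)
    from this[of a] this[of "- a"]
    show "norm (- f (Poly_Mapping.single i a)) \<le> norm a * 1"
      by (simp add: single_uminus linear_neg[OF f(1)])
  qed
  then have x_apply: "x i a = - f (Poly_Mapping.single i a)" for i a
    by (simp add: x_def bounded_linear_Blinfun_apply)
  have sum_x: "(\<Sum>i=1..n. x i (a i)) = - f (config a)" for a
    by (simp add: x_apply config_def linear_sum[OF f(1)] sum_negf)
  have sum_x_le: "(\<Sum>i=1..n. x i (a i)) \<le> c"
    if "\<And>i. i \<in> {1..n} \<Longrightarrow> norm (w + a i) \<le> c" for a w c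
  proof -
    have "f (config (\<lambda>i. - a i)) \<le> c"
      by (rule f_le[where w = w]) (simp add: lookup_config that)
    then show ?thesis
      using sum_x[of "\<lambda>i. - a i"] by (simp add: blinfun.minus_right sum_negf)
  qed
  have zero: "(\<Sum>i=1..n. x i) = 0"
  proof (rule blinfun_eqI)
    fix a
    have "(\<Sum>i=1..n. x i a) \<le> 0" for a
      by (rule sum_x_le[where w = "- a"]) simp
    from this[of a] this[of "- a"] show "(\<Sum>i=1..n. x i) a = blinfun_apply 0 a"
      by (simp add: blinfun.sum_left blinfun.minus_right sum_negf)
  qed
  moreover have "(\<Sum>i=1..n. norm (x i)) \<le> 1"
  proof (rule field_le_epsilon)
    fix e :: real assume "0 < e"
    \<comment> \<open>The error is split evenly over \<open>n\<close> nearly norming vectors; the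
      configuration of their negatives lies in the unit ball, so its radius is at most 1.\<close>
    then have e: "0 < e / n" using n by simp
    have "\<exists>a. norm a \<le> 1 \<and> norm (x i) - e / n < x i a" for i
      by (rule blinfun_nearly_norming[OF e])
    then obtain a where a: "\<And>i. norm (a i) \<le> 1" "\<And>i. norm (x i) - e / n < x i (a i)"
      by metis
    have "(\<Sum>i=1..n. norm (x i)) \<le> (\<Sum>i=1..n. x i (a i) + e / n)"
      by (rule sum_mono) (use a(2) in \<open>simp add: less_eq_real_def algebra_simps\<close>)
    also have "\<dots> = (\<Sum>i=1..n. x i (a i)) + e"
      using n by (simp add: sum.distrib)
    also have "\<dots> \<le> 1 + e"
      using sum_x_le[where w = 0 and c = 1] a(1) by simp
    finally show "(\<Sum>i=1..n. norm (x i)) \<le> 1 + e" .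
  qed
  moreover have "(\<Sum>i=1..n. x i (u - v i)) = max_dist n v u"
  proof -
    \<comment> \<open>Moving the centre to 0 leaves only the value of \<open>f\<close> at
      \<open>v\<close>, where it touches the radius.\<close>
    have "(\<Sum>i=1..n. x i (u - v i)) = (\<Sum>i=1..n. x i (0 - v i))"
      by (rule sum_blinfun_shift[OF zero])
    also have "\<dots> = f (config v)"
      using sum_x[of v] by (simp add: blinfun.minus_right sum_negf)
    also have "\<dots> = max_dist n v u"
      using f(3) chebyshev_radius_eq[OF u n] lookup_config by simp
    finally show ?thesis .
  qed
  ultimately show thesis by (rule that)
qed

section \<open>Necessity of the optimality system\<close>

lemma blinfun_le_norm_mult: "blinfun_apply f a \<le> norm f * norm a"
  for f :: "'a::real_normed_vector dual"
  using norm_blinfun[of f a] by simp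

text \<open>With \<open>r\<close> the optimal value, the sums of \<open>x i (u - v i)\<close>,
  \<open>norm (x i) * norm (u - v i)\<close> and \<open>norm (x i) * r\<close> increase from
  \<open>r\<close> to at most \<open>r\<close>. Cancelling \<open>r\<close> normalizes the norms,
  and equality in each term gives alignment and complementarity.\<close>

lemma optimality_system_exists:
  fixes v :: "nat \<Rightarrow> 'a::real_normed_vector"
  assumes u: "u \<in> Sol n v" and n: "1 \<le> n" and pos: "0 < max_dist n v u"
  obtains x :: "nat \<Rightarrow> 'a dual" where "optimality_system n v u x"
proof -
  let ?r = "max_dist n v u"
  obtain x :: "nat \<Rightarrow> 'a dual" where x: "(\<Sum>i=1..n. x i) = 0"
    "(\<Sum>i=1..n. norm (x i)) \<le> 1" "(\<Sum>i=1..n. x i (u - v i)) = ?r"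
    using dual_certificate_exists[OF u n] by blast
  have le1: "x i (u - v i) \<le> norm (x i) * norm (u - v i)" for i
    by (rule blinfun_le_norm_mult)
  have le2: "norm (x i) * norm (u - v i) \<le> norm (x i) * ?r" if "i \<in> {1..n}" for i
    by (intro mult_left_mono norm_le_max_dist that) simp
  have le: "x i (u - v i) \<le> norm (x i) * ?r" if "i \<in> {1..n}" for i
    using le1[of i] le2[OF that] by linarith
  have "(\<Sum>i=1..n. x i (u - v i)) \<le> (\<Sum>i=1..n. norm (x i) * ?r)"
    by (rule sum_mono[OF le])
  then have ge: "?r \<le> (\<Sum>i=1..n. norm (x i)) * ?r"
    using x(3) by (simp only: sum_distrib_right)
  then have one: "(\<Sum>i=1..n. norm (x i)) = 1"
    using x(2) pos by simp
  then have sum_eq: "(\<Sum>i=1..n. x i (u - v i)) = (\<Sum>i=1..n. norm (x i) * ?r)"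
    using x(3) by (simp flip: sum_distrib_right)
  have eq: "x i (u - v i) = norm (x i) * ?r" if "i \<in> {1..n}" for i
    by (rule sum_mono_inv[OF sum_eq]) (use le that in auto)
  have "optimality_system n v u x"
    unfolding optimality_system_def
  proof (intro conjI ballI x(1) one)
    fix i assume i: "i \<in> {1..n}"
    show "x i (u - v i) = norm (x i) * norm (u - v i)"
      using eq[OF i] le1[of i] le2[OF i] by linarith
    then show "(norm (u - v i) - ?r) * norm (x i) = 0"
      using eq[OF i] by auto
  qed
  then show thesis by (rule that)
qed

section \<open>Sufficiency and the shape of the solution set\<close>

lemma optimality_system_sum:
  assumes "optimality_system n v u x"
  shows "(\<Sum>i=1..n. x i (w - v i)) = max_dist n v u"
proof -
  have x: "(\<Sum>i=1..n. x i) = 0" "(\<Sum>i=1..n. norm (x i)) = 1"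
    using assms by (auto simp: optimality_system_def)
  have eq: "x i (u - v i) = norm (x i) * max_dist n v u" if "i \<in> {1..n}" for i
    using assms that by (auto simp: optimality_system_def algebra_simps)
  have "(\<Sum>i=1..n. x i (w - v i)) = (\<Sum>i=1..n. x i (u - v i))"
    by (rule sum_blinfun_shift[OF x(1)])
  also have "\<dots> = (\<Sum>i=1..n. norm (x i) * max_dist n v u)"
    by (rule sum.cong) (use eq in auto)
  also have "\<dots> = max_dist n v u"
    using x(2) by (simp flip: sum_distrib_right)
  finally show ?thesis .
qed

text \<open>The left sides sum to the value at \<open>u\<close>, the right sides to the value at
  \<open>w\<close>. Termwise comparison makes \<open>u\<close> optimal, and \<open>w\<close> is
  optimal exactly when no term is strict.\<close>

lemma Sol_iff_of_optimality_system:
  assumes x: "optimality_system n v u x"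
  shows optimality_system_imp_Sol: "u \<in> Sol n v"
    and "w \<in> Sol n v \<longleftrightarrow> (\<forall>i\<in>{1..n}. x i (w - v i) = norm (x i) * max_dist n v w)"
proof -
  have le: "x i (w - v i) \<le> norm (x i) * max_dist n v w" if "i \<in> {1..n}" for i w
    using blinfun_le_norm_mult[of "x i" "w - v i"]
      mult_left_mono[OF norm_le_max_dist[OF that, of w v], of "norm (x i)"] by simp
  have sum: "(\<Sum>i=1..n. norm (x i) * max_dist n v w) = max_dist n v w" for w
    using x by (simp add: optimality_system_def flip: sum_distrib_right)
  have ge: "max_dist n v u \<le> max_dist n v w" for w
  proof -
    have "(\<Sum>i=1..n. x i (w - v i)) \<le> (\<Sum>i=1..n. norm (x i) * max_dist n v w)"
      by (rule sum_mono[OF le])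
    then show ?thesis by (simp only: optimality_system_sum[OF x] sum)
  qed
  then show "u \<in> Sol n v" by (simp add: Sol_def)
  have "w \<in> Sol n v \<longleftrightarrow> max_dist n v w = max_dist n v u"
    using ge by (force simp: Sol_def intro: antisym)
  also have "\<dots> \<longleftrightarrow> (\<Sum>i=1..n. x i (w - v i)) = (\<Sum>i=1..n. norm (x i) * max_dist n v w)"
    by (simp only: sum optimality_system_sum[OF x] eq_commute)
  also have "\<dots> \<longleftrightarrow> (\<forall>i\<in>{1..n}. x i (w - v i) = norm (x i) * max_dist n v w)"
  proof
    assume sum_eq: "(\<Sum>i=1..n. x i (w - v i)) = (\<Sum>i=1..n. norm (x i) * max_dist n v w)"
    show "\<forall>i\<in>{1..n}. x i (w - v i) = norm (x i) * max_dist n v w"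
      by (rule ballI, rule sum_mono_inv[OF sum_eq]) (use le in auto)
  qed (blast intro: sum.cong)
  finally show "w \<in> Sol n v \<longleftrightarrow>
    (\<forall>i\<in>{1..n}. x i (w - v i) = norm (x i) * max_dist n v w)" .
qed

theorem theorem6p1:
  fixes v :: "nat \<Rightarrow> 'a::real_normed_vector" and n :: nat
  assumes "n \<ge> 2" and "inj_on v {1..n}"
  shows "(\<forall>u. u \<in> Sol n v \<longleftrightarrow> (\<exists>x :: nat \<Rightarrow> 'a dual. optimality_system n v u x)) \<and>
    (\<forall>u (x :: nat \<Rightarrow> 'a dual). u \<in> Sol n v \<and> optimality_system n v u x \<longrightarrow>
       Sol n v = (\<Inter>i\<in>{i\<in>{1..n}. x i \<noteq> 0}.
         {w. blinfun_apply (x i) (w - v i) = norm (x i) * max_dist n v w}))"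
proof (intro conjI allI impI)
  fix u
  show "u \<in> Sol n v \<longleftrightarrow> (\<exists>x :: nat \<Rightarrow> 'a dual. optimality_system n v u x)"
    using optimality_system_exists[OF _ _ max_dist_pos[OF assms]] optimality_system_imp_Sol assms(1)
    by (metis one_le_numeral order_trans)
next
  fix u and x :: "nat \<Rightarrow> 'a dual"
  assume "u \<in> Sol n v \<and> optimality_system n v u x"
  then have "w \<in> Sol n v \<longleftrightarrow> (\<forall>i\<in>{1..n}. x i (w - v i) = norm (x i) * max_dist n v w)" for w
    using Sol_iff_of_optimality_system(2) by blast
  \<comment> \<open>Indices with \<open>x i = 0\<close> contribute only \<open>0 = 0\<close>, so
    they can be left out of the intersection.\<close>
  then show "Sol n v = (\<Inter>i\<in>{i\<in>{1..n}. x i \<noteq> 0}.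
      {w. blinfun_apply (x i) (w - v i) = norm (x i) * max_dist n v w})"
    by (auto intro: zero_blinfun.rep_eq) fastforce
qed

end
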